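(* Let $N \ge 1$ be an integer and let $p$ be a real number with $N < p < \infty$. Then there exists a constant $C_{N,p} > 0$, depending only on $N$ and $p$, such that for every bounded domain $\Omega \subset \mathbb{R}^N$, $$\lambda_{1,p}(\Omega) \geq C_{N,p}\, \rho_{\Omega}^{-p}.$$
   Context: A domain is a nonempty connected open set. For $1<p<\infty$ and a bounded domain $\Omega \subset \mathbb{R}^N$, $\lambda_{1,p}(\Omega)$ denotes the first eigenvalue of the Dirichlet $p$-Laplacian, i.e. of the problem $\operatorname{div}(|\nabla u|^{p-2}\nabla u) + \lambda |u|^{p-2}u = 0$ in $\Omega$, $u \in W^{1,p}_0(\Omega)$ (weak sense). It is characterized variationally by $$\lambda_{1,p}(\Omega) = \inf_{0 \neq u\in C^\infty_0(\Omega)} \frac{ \int_\Omega |\nabla u|^p \, dx}{\int_\Omega |u|^p \, dx},$$ the infimum being attained by a function in $W^{1,p}_0(\Omega)$. The inradius of $\Omega$ is $\rho_\Omega := \sup\{ r > 0 : \text{there is an open ball } B_r \text{ of radius } r \text{ with } B_r \subset \Omega\}$. *)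

theory Defs
  imports "HOL-Analysis.Analysis"
begin

definition bounded_domain :: "'a::euclidean_space set \<Rightarrow> bool" where
  "bounded_domain \<Omega> \<longleftrightarrow> \<Omega> \<noteq> {} \<and> open \<Omega> \<and> connected \<Omega> \<and> bounded \<Omega>"

definition inradius :: "'a::euclidean_space set \<Rightarrow> real" where
  "inradius \<Omega> = Sup {r. r > 0 \<and> (\<exists>x. ball x r \<subseteq> \<Omega>)}"

definition partial_deriv :: "'a \<Rightarrow> ('a::euclidean_space \<Rightarrow> real) \<Rightarrow> 'a \<Rightarrow> real" where
  "partial_deriv b f x = frechet_derivative f (at x) b"

definition grad :: "('a::euclidean_space \<Rightarrow> real) \<Rightarrow> 'a \<Rightarrow> 'a" where
  "grad f x = (\<Sum>b\<in>Basis. partial_deriv b f x *\<^sub>R b)"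

text \<open>A function of class \<open>C\<^sup>k\<^sup>+\<^sup>1\<close> is a differentiable one all of whose partial derivatives
  are of class \<open>C\<^sup>k\<close>.\<close>

fun Ck :: "nat \<Rightarrow> ('a::euclidean_space \<Rightarrow> real) \<Rightarrow> bool" where
  "Ck 0 f \<longleftrightarrow> continuous_on UNIV f"
| "Ck (Suc k) f \<longleftrightarrow> (\<forall>x. f differentiable at x) \<and> (\<forall>b\<in>Basis. Ck k (partial_deriv b f))"

text \<open>The space \<open>C\<^sub>0\<^sup>\<infinity>(\<Omega>)\<close>, its elements being extended by zero to the whole space.\<close>

definition test_functions :: "'a::euclidean_space set \<Rightarrow> ('a \<Rightarrow> real) set" where
  "test_functions \<Omega> = {\<phi>. (\<forall>k. Ck k \<phi>) \<and> compact (closure {x. \<phi> x \<noteq> 0}) \<and> closure {x. \<phi> x \<noteq> 0} \<subseteq> \<Omega>}"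

definition Lp_on ::
  "real \<Rightarrow> 'a::euclidean_space set \<Rightarrow> ('a \<Rightarrow> 'b::euclidean_space) \<Rightarrow> bool" where
  "Lp_on p \<Omega> f \<longleftrightarrow> set_borel_measurable lebesgue \<Omega> f \<and>
     set_integrable lebesgue \<Omega> (\<lambda>x. norm (f x) powr p)"

definition weak_gradient ::
  "'a::euclidean_space set \<Rightarrow> ('a \<Rightarrow> real) \<Rightarrow> ('a \<Rightarrow> 'a) \<Rightarrow> bool" where
  "weak_gradient \<Omega> u g \<longleftrightarrow> (\<forall>\<phi>\<in>test_functions \<Omega>. \<forall>b\<in>Basis.
     (LINT x:\<Omega>|lebesgue. u x * partial_deriv b \<phi> x) = - (LINT x:\<Omega>|lebesgue. (g x \<bullet> b) * \<phi> x))"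

text \<open>\<open>W1p p \<Omega> u g\<close>: \<open>u\<close> is in \<open>W\<^sup>1\<^sup>,\<^sup>p(\<Omega>)\<close> and \<open>g\<close> represents its gradient, which is unique
  only up to null sets. Likewise for \<open>W1p0\<close> and the closure \<open>W\<^sub>0\<^sup>1\<^sup>,\<^sup>p(\<Omega>)\<close> of \<open>C\<^sub>0\<^sup>\<infinity>(\<Omega>)\<close> in the
  norm of \<open>W\<^sup>1\<^sup>,\<^sup>p(\<Omega>)\<close>.\<close>

definition W1p :: "real \<Rightarrow> 'a::euclidean_space set \<Rightarrow> ('a \<Rightarrow> real) \<Rightarrow> ('a \<Rightarrow> 'a) \<Rightarrow> bool" where
  "W1p p \<Omega> u g \<longleftrightarrow> Lp_on p \<Omega> u \<and> Lp_on p \<Omega> g \<and> weak_gradient \<Omega> u g"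

definition W1p0 :: "real \<Rightarrow> 'a::euclidean_space set \<Rightarrow> ('a \<Rightarrow> real) \<Rightarrow> ('a \<Rightarrow> 'a) \<Rightarrow> bool" where
  "W1p0 p \<Omega> u g \<longleftrightarrow> W1p p \<Omega> u g \<and>
     (\<exists>\<phi>. (\<forall>n::nat. \<phi> n \<in> test_functions \<Omega>) \<and>
       (\<lambda>n. LINT x:\<Omega>|lebesgue. \<bar>\<phi> n x - u x\<bar> powr p) \<longlonglongrightarrow> 0 \<and>
       (\<lambda>n. LINT x:\<Omega>|lebesgue. norm (grad (\<phi> n) x - g x) powr p) \<longlonglongrightarrow> 0)"

text \<open>Eigenvalues of \<open>div(|\<nabla>u|\<^sup>p\<^sup>-\<^sup>2\<nabla>u) + \<lambda>|u|\<^sup>p\<^sup>-\<^sup>2u = 0\<close>, \<open>u \<in> W\<^sub>0\<^sup>1\<^sup>,\<^sup>p(\<Omega>)\<close>, in the weak sense. For \<open>p < 2\<close>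
  the value \<open>0 powr (p - 2) = 0\<close> gives the vector field \<open>|g|\<^sup>p\<^sup>-\<^sup>2g\<close> its usual value \<open>0\<close> where \<open>g\<close>
  vanishes.\<close>

definition dirichlet_eigenvalue :: "real \<Rightarrow> 'a::euclidean_space set \<Rightarrow> real \<Rightarrow> bool" where
  "dirichlet_eigenvalue p \<Omega> l \<longleftrightarrow> (\<exists>u g. W1p0 p \<Omega> u g \<and>
     \<not> (AE x in lebesgue. x \<in> \<Omega> \<longrightarrow> u x = 0) \<and>
     (\<forall>\<phi>\<in>test_functions \<Omega>.
       (LINT x:\<Omega>|lebesgue. norm (g x) powr (p - 2) * (g x \<bullet> grad \<phi> x)) =
       l * (LINT x:\<Omega>|lebesgue. \<bar>u x\<bar> powr (p - 2) * u x * \<phi> x)))"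

definition first_eigenvalue :: "real \<Rightarrow> 'a::euclidean_space set \<Rightarrow> ereal" where
  "first_eigenvalue p \<Omega> = (INF l\<in>{l. dirichlet_eigenvalue p \<Omega> l}. ereal l)"

text \<open>For bounded domains and \<open>1 < p\<close> this infimum is attained in \<open>W\<^sub>0\<^sup>1\<^sup>,\<^sup>p(\<Omega>)\<close>, and it is the first
  eigenvalue. Both infima are taken in \<open>ereal\<close>, where no nonemptiness proviso is needed.\<close>

definition rayleigh_infimum :: "real \<Rightarrow> 'a::euclidean_space set \<Rightarrow> ereal" where
  "rayleigh_infimum p \<Omega> = (INF \<phi>\<in>test_functions \<Omega> - {\<lambda>x. 0}.
     ereal ((LINT x:\<Omega>|lebesgue. norm (grad \<phi> x) powr p) / (LINT x:\<Omega>|lebesgue. \<bar>\<phi> x\<bar> powr p)))"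

end

theory Submission
  imports Defs
begin

text \<open>Let \<open>\<rho>\<close> be the inradius and tile the space by half-open cubes of side \<open>4 \<rho>\<close>. Each cube contains a
  ball of radius \<open>2 \<rho>\<close>, hence a point \<open>z\<close> outside \<open>\<Omega>\<close>, where every test function vanishes. For \<open>p > N\<close> a
  single zero suffices for a Poincare inequality on a convex set: integrate the gradient along the
  segments from \<open>z\<close>, apply Jensen's inequality and Fubini's theorem, and undo the homothety centred
  at \<open>z\<close>. Summing over the cubes bounds the Rayleigh quotient of test functions. An eigenfunction
  \<open>u\<close> is a limit of test functions; testing its equation against them identifies the eigenvalue with
  the Rayleigh quotient of \<open>u\<close>, and the Poincare inequality passes to the limit up to a
  factor \<open>4 powr p\<close>.\<close>

section \<open>Convexity of powers and the Poincare inequality on convex sets\<close>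

text \<open>Convexity in tangent form. Young's inequality with exponents \<open>p\<close> and
  \<open>p / (p - 1)\<close>, applied to \<open>a\<close> and \<open>c powr (p - 1)\<close>, gives
  it at once and covers the point \<open>c = 0\<close>.\<close>

lemma powr_tangent_le:
  fixes a c p :: real
  assumes "1 < p" "0 \<le> a" "0 \<le> c"
  shows "c powr p + p * c powr (p - 1) * (a - c) \<le> a powr p"
proof -
  have "a * c powr (p - 1) \<le> a powr p / p + (c powr (p - 1)) powr (p / (p - 1)) / (p / (p - 1))"
    using assms by (intro Youngs_inequality) (auto simp: field_simps)
  moreover have "(c powr (p - 1)) powr (p / (p - 1)) = c powr p"
    using assms by (simp add: powr_powr)
  moreover have "c powr (p - 1) * c = c powr p"
    using assms by (cases "c = 0") (auto simp: powr_diff)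
  ultimately show ?thesis
    using assms by (simp add: field_simps)
qed

text \<open>Jensen's inequality: integrate the tangent inequality at the mean value \<open>c\<close>
  of \<open>f\<close>; the linear term has integral zero.\<close>

lemma powr_integral_le:
  fixes f :: "real \<Rightarrow> real"
  assumes p: "1 < p" and f: "continuous_on {0..1} f" and nonneg: "\<And>x. x \<in> {0..1} \<Longrightarrow> 0 \<le> f x"
  shows "integral {0..1} f powr p \<le> integral {0..1} (\<lambda>x. f x powr p)"
proof -
  define c where "c = integral {0..1} f"
  have c: "0 \<le> c"
    unfolding c_def by (intro integral_nonneg integrable_continuous_interval f nonneg)
  have cont: "continuous_on {0..1} (\<lambda>x. f x powr p)"
    using p nonneg by (intro continuous_on_powr' f) auto
  have "((\<lambda>x. c powr p + p * c powr (p - 1) * (f x - c)) has_integral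
      (c powr p + p * c powr (p - 1) * (c - c))) {0..1}"
    using has_integral_const_real[of "c powr p" 0 1] has_integral_const_real[of c 0 1]
      integrable_integral[OF integrable_continuous_interval[OF f]]
    by (intro has_integral_add has_integral_mult_right has_integral_diff) (auto simp: c_def)
  then have "c powr p + p * c powr (p - 1) * (c - c) \<le> integral {0..1} (\<lambda>x. f x powr p)"
    using powr_tangent_le[OF p nonneg c]
    by (rule has_integral_le[OF _ integrable_integral[OF integrable_continuous_interval[OF cont]]]) auto
  then show ?thesis by (simp add: c_def)
qed

lemma nn_integral_homothety:
  fixes z :: "'a::euclidean_space" and F :: "'a \<Rightarrow> ennreal"
  assumes "0 < c" and [measurable]: "F \<in> borel_measurable borel"
  shows "(\<integral>\<^sup>+x. F x \<partial>lborel) = ennreal (c ^ DIM('a)) * (\<integral>\<^sup>+x. F (z + c *\<^sub>R (x - z)) \<partial>lborel)"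
proof -
  have "(\<integral>\<^sup>+x. F x \<partial>lborel) =
      (\<integral>\<^sup>+x. F x \<partial>density (distr lborel borel (\<lambda>x. (z - c *\<^sub>R z) + c *\<^sub>R x)) (\<lambda>_. \<bar>c\<bar>^DIM('a)))"
    using assms by (subst lborel_affine[of c "z - c *\<^sub>R z"]) auto
  also have "\<dots> = (\<integral>\<^sup>+x. ennreal (c ^ DIM('a)) * F (z + c *\<^sub>R (x - z)) \<partial>lborel)"
    using assms by (simp add: nn_integral_density nn_integral_distr algebra_simps)
  finally show ?thesis
    by (simp add: nn_integral_cmult)
qed

text \<open>The substitution \<open>t = s ^ m\<close> on the segment from \<open>z\<close> to \<open>x\<close> produces the factor \<open>s ^ (m - 1)\<close>,
  which for large \<open>m\<close> absorbs the Jacobian \<open>s ^ (- m N)\<close> of the homothety \<open>x \<mapsto> z + s ^ m (x - z)\<close>.\<close>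

lemma powr_le_nn_integral_segment:
  fixes f :: "'a::euclidean_space \<Rightarrow> real" and G :: "'a \<Rightarrow> 'a"
  assumes deriv: "\<And>x. (f has_derivative (\<lambda>h. G x \<bullet> h)) (at x)"
    and G: "continuous_on UNIV G"
    and p: "1 < p" and m: "0 < m" and z: "f z = 0" and d: "norm (x - z) \<le> d"
  shows "ennreal (\<bar>f x\<bar> powr p) \<le>
    (\<integral>\<^sup>+s\<in>{0..1}. ennreal ((real m * d * s ^ (m - 1) * norm (G (z + s ^ m *\<^sub>R (x - z)))) powr p) \<partial>lborel)"
proof -
  \<comment> \<open>A bound for the derivative of \<open>f\<close> along the curve
    \<open>z + s ^ m *\<^sub>R (x - z)\<close>. Writing \<open>d\<close> for the length of
    \<open>x - z\<close> keeps the prefactor independent of \<open>x\<close> when \<open>x\<close>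
    is integrated later.\<close>
  define h where "h s = real m * d * s ^ (m - 1) * norm (G (z + s ^ m *\<^sub>R (x - z)))" for s
  have d0: "0 \<le> d" using d norm_ge_zero order_trans by blast
  have Gc: "continuous_on A (\<lambda>s. G (z + s ^ m *\<^sub>R (x - z)))" for A
    by (rule continuous_on_compose2[OF G]) (auto intro!: continuous_intros)
  have h: "continuous_on {0..1} h"
    unfolding h_def by (intro continuous_intros Gc)
  have hpos: "0 \<le> h s" if "s \<in> {0..1}" for s
    using that d0 by (auto simp: h_def)
  have "((\<lambda>s. f (z + s ^ m *\<^sub>R (x - z))) has_vector_derivative
      G (z + s ^ m *\<^sub>R (x - z)) \<bullet> ((real m * s ^ (m - 1)) *\<^sub>R (x - z))) (at s within {0..1})" for s
    unfolding has_vector_derivative_def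
    by (rule has_derivative_compose[OF _ deriv, THEN has_derivative_eq_rhs])
      (auto intro!: derivative_eq_intros simp: fun_eq_iff)
  then have "((\<lambda>s. G (z + s ^ m *\<^sub>R (x - z)) \<bullet> ((real m * s ^ (m - 1)) *\<^sub>R (x - z))) has_integral
      (f (z + 1 ^ m *\<^sub>R (x - z)) - f (z + 0 ^ m *\<^sub>R (x - z)))) {0..1}"
    by (intro fundamental_theorem_of_calculus) auto
  moreover have "norm (G (z + s ^ m *\<^sub>R (x - z)) \<bullet> ((real m * s ^ (m - 1)) *\<^sub>R (x - z))) \<le> h s"
    if "s \<in> {0..1}" for s
  proof -
    have "norm (G (z + s ^ m *\<^sub>R (x - z)) \<bullet> ((real m * s ^ (m - 1)) *\<^sub>R (x - z)))
        \<le> norm (G (z + s ^ m *\<^sub>R (x - z))) * ((real m * s ^ (m - 1)) * norm (x - z))"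
      using that Cauchy_Schwarz_ineq2[of "G (z + s ^ m *\<^sub>R (x - z))" "(real m * s ^ (m - 1)) *\<^sub>R (x - z)"]
      by simp
    also have "\<dots> \<le> norm (G (z + s ^ m *\<^sub>R (x - z))) * ((real m * s ^ (m - 1)) * d)"
      using that d by (intro mult_left_mono) auto
    finally show ?thesis by (simp add: h_def mult_ac)
  qed
  ultimately have le: "\<bar>f x - f (z + 0 ^ m *\<^sub>R (x - z))\<bar> \<le> integral {0..1} h"
    using integral_norm_bound_integral[OF _ integrable_continuous_interval[OF h]]
    by (fastforce simp: has_integral_iff)
  \<comment> \<open>As \<open>0 < m\<close>, the curve starts at \<open>z\<close>, where
    \<open>f\<close> vanishes.\<close>
  have "\<bar>f x\<bar> \<le> integral {0..1} h"
    using le m z by (simp add: power_0_left)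
  then have "\<bar>f x\<bar> powr p \<le> integral {0..1} h powr p"
    using p by (intro powr_mono2) auto
  also have "\<dots> \<le> integral {0..1} (\<lambda>s. h s powr p)"
    by (rule powr_integral_le[OF p h hpos])
  finally have "ennreal (\<bar>f x\<bar> powr p) \<le> ennreal (integral {0..1} (\<lambda>s. h s powr p))"
    by (rule ennreal_leI)
  also have "\<dots> = (\<integral>\<^sup>+s. ennreal (h s powr p) * indicator {0..1} s \<partial>lborel)"
    using p hpos
    by (intro nn_integral_has_integral_lebesgue'[symmetric] integrable_integral
        integrable_continuous_interval continuous_on_powr' h) auto
  finally show ?thesis by (simp add: h_def)
qed

text \<open>For fixed \<open>s\<close> the homothety maps \<open>S\<close> into itself, and its
  inverse Jacobian \<open>s ^ (- m N)\<close> is compensated by the \<open>p\<close>-th power of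
  \<open>s ^ (m - 1)\<close>. This is the condition on \<open>m\<close>, which can be met only for
  \<open>p > DIM('a)\<close>. The bound for a slice does not depend on \<open>s\<close>, so
  integrating over the unit interval keeps it.\<close>

lemma nn_integral_powr_le_convex:
  fixes f :: "'a::euclidean_space \<Rightarrow> real" and G :: "'a \<Rightarrow> 'a"
  assumes deriv: "\<And>x. (f has_derivative (\<lambda>h. G x \<bullet> h)) (at x)"
    and G: "continuous_on UNIV G"
    and S: "convex S" and S_borel [measurable]: "S \<in> sets borel"
    and z: "z \<in> S" "f z = 0" and d: "\<And>x. x \<in> S \<Longrightarrow> norm (x - z) \<le> d"
    and p: "1 < p" and m: "1 < m" "real m * DIM('a) \<le> real (m - 1) * p"
  shows "(\<integral>\<^sup>+x\<in>S. ennreal (\<bar>f x\<bar> powr p) \<partial>lborel) \<le>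
    ennreal ((real m * d) powr p) * (\<integral>\<^sup>+x\<in>S. ennreal (norm (G x) powr p) \<partial>lborel)"
proof -
  have [measurable]: "G \<in> borel_measurable borel"
    by (rule borel_measurable_continuous_onI[OF G])
  have d0: "0 \<le> d" using d[OF z(1)] by simp
  define F where "F x = ennreal (norm (G x) powr p) * indicator S x" for x
  have [measurable]: "F \<in> borel_measurable borel"
    unfolding F_def by measurable
  define H where "H s x = ennreal ((real m * d * s ^ (m - 1) * norm (G (z + s ^ m *\<^sub>R (x - z)))) powr p)" for s x
  have [measurable]: "case_prod H \<in> borel_measurable (borel \<Otimes>\<^sub>M borel)"
    unfolding H_def by measurable
  have slice: "(\<integral>\<^sup>+x\<in>S. H s x \<partial>lborel) \<le> ennreal ((real m * d) powr p) * (\<integral>\<^sup>+x. F x \<partial>lborel)"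
    if s: "0 \<le> s" "s \<le> 1" for s
  proof (cases "s = 0")
    case True
    \<comment> \<open>The homothety degenerates here, but \<open>1 < m\<close> makes
      \<open>0 ^ (m - 1)\<close> zero and the integrand vanishes.\<close>
    with m show ?thesis by (simp add: H_def power_0_left)
  next
    case False
    with s have s0: "0 < s" by simp
    let ?I = "\<integral>\<^sup>+x. F (z + s ^ m *\<^sub>R (x - z)) \<partial>lborel"
    have pow: "(s ^ (m - 1)) powr p \<le> (s ^ m) ^ DIM('a)"
    proof -
      have "(s ^ (m - 1)) powr p = s powr (real (m - 1) * p)"
        using s0 by (simp add: powr_realpow[symmetric] powr_powr)
      \<comment> \<open>The base is at most 1, so the larger exponent gives the smaller power; the
        condition on \<open>m\<close> enters here.\<close>
      also have "\<dots> \<le> s powr (real m * DIM('a))"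
        using s0 s m by (intro powr_mono') auto
      also have "\<dots> = (s ^ m) ^ DIM('a)"
        using s0 by (simp add: powr_realpow power_mult flip: of_nat_mult)
      finally show ?thesis .
    qed
    have "H s x * indicator S x \<le>
        ennreal ((real m * d) powr p * (s ^ (m - 1)) powr p) * F (z + s ^ m *\<^sub>R (x - z))" for x
    proof (cases "x \<in> S")
      case True
      \<comment> \<open>The moved point is a convex combination of \<open>z\<close> and
        \<open>x\<close>, so the indicator of \<open>S\<close> inside \<open>F\<close> equals 1
        there.\<close>
      have "(1 - s ^ m) *\<^sub>R z + s ^ m *\<^sub>R x \<in> S"
        using s z True by (intro convexD[OF S]) (auto simp: power_le_one)
      then have "z + s ^ m *\<^sub>R (x - z) \<in> S"
        by (simp add: algebra_simps)
      then show ?thesis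
        using True s d0 by (simp add: H_def F_def powr_mult mult_ac flip: ennreal_mult')
    qed simp
    then have "(\<integral>\<^sup>+x\<in>S. H s x \<partial>lborel) \<le>
        (\<integral>\<^sup>+x. ennreal ((real m * d) powr p * (s ^ (m - 1)) powr p) * F (z + s ^ m *\<^sub>R (x - z)) \<partial>lborel)"
      by (intro nn_integral_mono)
    also have "\<dots> = ennreal ((real m * d) powr p) * (ennreal ((s ^ (m - 1)) powr p) * ?I)"
      by (simp add: nn_integral_cmult ennreal_mult mult_ac)
    also have "\<dots> \<le> ennreal ((real m * d) powr p) * (ennreal ((s ^ m) ^ DIM('a)) * ?I)"
      using pow by (intro mult_left_mono mult_right_mono ennreal_leI) auto
    also have "ennreal ((s ^ m) ^ DIM('a)) * ?I = (\<integral>\<^sup>+x. F x \<partial>lborel)"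
      using s0 by (intro nn_integral_homothety[symmetric]) auto
    finally show ?thesis .
  qed
  have "ennreal (\<bar>f x\<bar> powr p) \<le> (\<integral>\<^sup>+s\<in>{0..1}. H s x \<partial>lborel)" if "x \<in> S" for x
    unfolding H_def using m by (intro powr_le_nn_integral_segment[OF deriv G p _ z(2) d[OF that]]) auto
  then have "(\<integral>\<^sup>+x\<in>S. ennreal (\<bar>f x\<bar> powr p) \<partial>lborel) \<le> (\<integral>\<^sup>+x\<in>S. (\<integral>\<^sup>+s\<in>{0..1}. H s x \<partial>lborel) \<partial>lborel)"
    by (intro nn_integral_mono) (auto split: split_indicator)
  also have "\<dots> = (\<integral>\<^sup>+x. (\<integral>\<^sup>+s. H s x * indicator {0..1} s * indicator S x \<partial>lborel) \<partial>lborel)"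
    by (subst nn_integral_multc) auto
  also have "\<dots> = (\<integral>\<^sup>+s. (\<integral>\<^sup>+x. H s x * indicator {0..1} s * indicator S x \<partial>lborel) \<partial>lborel)"
    by (intro lborel_pair.Fubini') measurable
  also have "\<dots> = (\<integral>\<^sup>+s\<in>{0..1}. (\<integral>\<^sup>+x\<in>S. H s x \<partial>lborel) \<partial>lborel)"
    by (subst nn_integral_multc[symmetric]) (auto simp: mult_ac)
  also have "\<dots> \<le> (\<integral>\<^sup>+s\<in>{0..1::real}. ennreal ((real m * d) powr p) * (\<integral>\<^sup>+x. F x \<partial>lborel) \<partial>lborel)"
    using slice by (intro nn_integral_mono) (auto split: split_indicator)
  also have "\<dots> = ennreal ((real m * d) powr p) * (\<integral>\<^sup>+x. F x \<partial>lborel)"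
    by (simp add: nn_integral_cmult_indicator)
  finally show ?thesis
    by (simp add: F_def)
qed

section \<open>Summation over a tiling by cubes\<close>

text \<open>A cube of side \<open>L\<close> contains the open ball of radius \<open>L / 2\<close>
  about its centre, hence a zero of \<open>f\<close>, and the convex case applies to it. The
  constant is the same for all cubes, so the estimates add up.\<close>

lemma nn_integral_powr_le_dense_zeros:
  fixes f :: "'a::euclidean_space \<Rightarrow> real" and G :: "'a \<Rightarrow> 'a" and L :: real
  assumes deriv: "\<And>x. (f has_derivative (\<lambda>h. G x \<bullet> h)) (at x)"
    and G: "continuous_on UNIV G"
    and L: "0 < L" and zeros: "\<And>y. \<exists>z\<in>ball y (L / 2). f z = 0"
    and p: "1 < p" and m: "1 < m" "real m * DIM('a) \<le> real (m - 1) * p"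
  shows "(\<integral>\<^sup>+x. ennreal (\<bar>f x\<bar> powr p) \<partial>lborel) \<le>
    ennreal ((real m * (DIM('a) * L)) powr p) * (\<integral>\<^sup>+x. ennreal (norm (G x) powr p) \<partial>lborel)"
proof -
  let ?K = "ennreal ((real m * (DIM('a) * L)) powr p)"
  define Q :: "('a \<Rightarrow> int) \<Rightarrow> 'a set" where
    "Q k = {x. \<forall>b\<in>Basis. of_int (k b) * L \<le> x \<bullet> b \<and> x \<bullet> b < (of_int (k b) + 1) * L}" for k
  \<comment> \<open>Extensional functions on \<open>Basis\<close> make the index of a cube unique,
    as disjointness requires; finiteness of \<open>Basis\<close> keeps \<open>I\<close>
    countable.\<close>
  define I :: "('a \<Rightarrow> int) set" where "I = PiE Basis (\<lambda>_. UNIV)"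
  have floor: "k b = \<lfloor>x \<bullet> b / L\<rfloor>" if "x \<in> Q k" "b \<in> Basis" for x k b
    using that L by (intro floor_unique[symmetric]) (auto simp: Q_def field_simps)
  have I: "countable I"
    unfolding I_def by (intro countable_PiE) auto
  have disj: "disjoint_family_on Q I"
  proof (unfold disjoint_family_on_def, intro ballI impI)
    fix k l assume kl: "k \<in> I" "l \<in> I" "k \<noteq> l"
    have "k = l" if "x \<in> Q k" "x \<in> Q l" for x
      using kl floor[OF that(1)] floor[OF that(2)] unfolding I_def by (intro PiE_ext) auto
    then show "Q k \<inter> Q l = {}" using kl by blast
  qed
  have cover: "(\<Union>k\<in>I. Q k) = UNIV"
  proof (intro equalityI subsetI)
    fix x :: 'a
    have "x \<in> Q (\<lambda>b\<in>Basis. \<lfloor>x \<bullet> b / L\<rfloor>)"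
      using L by (auto simp: Q_def pos_le_divide_eq[symmetric] pos_divide_less_eq[symmetric])
    moreover have "(\<lambda>b\<in>Basis. \<lfloor>x \<bullet> b / L\<rfloor>) \<in> I"
      by (auto simp: I_def)
    ultimately show "x \<in> (\<Union>k\<in>I. Q k)" by blast
  qed simp
  have Q_borel [measurable]: "Q k \<in> sets borel" for k
    unfolding Q_def by measurable
  have Q_convex: "convex (Q k)" for k
  proof -
    have "Q k = (\<Inter>b\<in>Basis. {x. b \<bullet> x \<ge> of_int (k b) * L} \<inter> {x. b \<bullet> x < (of_int (k b) + 1) * L})"
      by (auto simp: Q_def inner_commute)
    then show ?thesis
      by (auto intro!: convex_INT convex_Int convex_halfspace_ge convex_halfspace_lt)
  qed
  have Q_diam: "norm (x - y) \<le> DIM('a) * L" if "x \<in> Q k" "y \<in> Q k" for x y k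
  proof -
    \<comment> \<open>Comparison with the sum norm is cruder than the sharp diameter
      \<open>sqrt DIM('a) * L\<close>, but affects only the constant.\<close>
    have "norm (x - y) \<le> (\<Sum>b\<in>Basis. \<bar>(x - y) \<bullet> b\<bar>)" by (rule norm_le_l1)
    also have "\<dots> \<le> sum (\<lambda>_. L) (Basis::'a set)"
    proof (rule sum_mono)
      fix b :: 'a assume b: "b \<in> Basis"
      with that have "of_int (k b) * L \<le> x \<bullet> b" "x \<bullet> b < of_int (k b) * L + L"
        "of_int (k b) * L \<le> y \<bullet> b" "y \<bullet> b < of_int (k b) * L + L"
        by (auto simp: Q_def algebra_simps)
      then show "\<bar>(x - y) \<bullet> b\<bar> \<le> L" by (simp add: inner_diff_left)
    qed
    finally show ?thesis by simp
  qed
  have Q_zero: "\<exists>z\<in>Q k. f z = 0" for k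
  proof -
    \<comment> \<open>The centre of the cube \<open>Q k\<close>.\<close>
    define y :: 'a where "y = (\<Sum>b\<in>Basis. (of_int (k b) * L + L / 2) *\<^sub>R b)"
    obtain z where z: "dist y z < L / 2" "f z = 0" using zeros[of y] by auto
    have "z \<in> Q k"
      unfolding Q_def
    proof (intro CollectI ballI)
      fix b :: 'a assume b: "b \<in> Basis"
      then have "\<bar>z \<bullet> b - (of_int (k b) * L + L / 2)\<bar> < L / 2"
        using Basis_le_norm[OF b, of "z - y"] z
        by (simp add: y_def dist_norm norm_minus_commute inner_diff_left)
      then show "of_int (k b) * L \<le> z \<bullet> b \<and> z \<bullet> b < (of_int (k b) + 1) * L"
        unfolding abs_less_iff distrib_right by linarith
    qed
    with z show ?thesis by blast
  qed
  have [measurable]: "G \<in> borel_measurable borel"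
    by (rule borel_measurable_continuous_onI[OF G])
  have [measurable]: "f \<in> borel_measurable borel"
    using deriv by (intro borel_measurable_continuous_onI)
      (auto intro!: continuous_at_imp_continuous_on has_derivative_continuous)
  \<comment> \<open>Reading both integrals as measures of the cells turns the summation over cubes
    into countable additivity.\<close>
  define \<mu> where "\<mu> = density lborel (\<lambda>x. ennreal (\<bar>f x\<bar> powr p))"
  define \<nu> where "\<nu> = density lborel (\<lambda>x. ennreal (norm (G x) powr p))"
  have cell: "emeasure \<mu> (Q k) \<le> ?K * emeasure \<nu> (Q k)" for k
  proof -
    obtain z where "z \<in> Q k" "f z = 0" using Q_zero by blast
    then show ?thesis
      unfolding \<mu>_def \<nu>_def
      using nn_integral_powr_le_convex[OF deriv G Q_convex Q_borel _ _ Q_diam p m, of z k]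
      by (simp add: emeasure_density)
  qed
  have "emeasure \<mu> UNIV = (\<integral>\<^sup>+k. emeasure \<mu> (Q k) \<partial>count_space I)"
    unfolding cover[symmetric] using I disj by (intro emeasure_UN_countable) (auto simp: \<mu>_def)
  also have "\<dots> \<le> (\<integral>\<^sup>+k. ?K * emeasure \<nu> (Q k) \<partial>count_space I)"
    by (intro nn_integral_mono cell)
  also have "\<dots> = ?K * (\<integral>\<^sup>+k. emeasure \<nu> (Q k) \<partial>count_space I)"
    by (intro nn_integral_cmult) auto
  also have "(\<integral>\<^sup>+k. emeasure \<nu> (Q k) \<partial>count_space I) = emeasure \<nu> UNIV"
    unfolding cover[symmetric] using I disj
    by (intro emeasure_UN_countable[symmetric]) (auto simp: \<nu>_def)
  finally show ?thesis
    by (simp add: \<mu>_def \<nu>_def emeasure_density)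
qed

section \<open>Test functions and their integrals\<close>

lemma Ck_imp_continuous:
  assumes "Ck k f"
  shows "continuous_on UNIV f"
  using assms
  by (cases k) (auto intro!: continuous_at_imp_continuous_on differentiable_imp_continuous_within)

lemma test_functionsD:
  assumes "\<phi> \<in> test_functions \<Omega>"
  shows test_functions_continuous: "continuous_on UNIV \<phi>"
    and test_functions_has_derivative: "(\<phi> has_derivative (\<lambda>h. grad \<phi> x \<bullet> h)) (at x)"
    and test_functions_continuous_grad: "continuous_on UNIV (grad \<phi>)"
    and test_functions_eq_0: "x \<notin> \<Omega> \<Longrightarrow> \<phi> x = 0"
    and test_functions_grad_eq_0: "x \<notin> closure {x. \<phi> x \<noteq> 0} \<Longrightarrow> grad \<phi> x = 0"
proof -
  have Ck: "Ck k \<phi>" for k using assms by (simp add: test_functions_def)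
  have supp: "closure {x. \<phi> x \<noteq> 0} \<subseteq> \<Omega>" using assms by (simp add: test_functions_def)
  show cont: "continuous_on UNIV \<phi>" by (rule Ck_imp_continuous[OF Ck])
  have diff: "(\<phi> has_derivative frechet_derivative \<phi> (at x)) (at x)" for x
    using Ck[of "Suc 0"] by (simp flip: frechet_derivative_works)
  have "frechet_derivative \<phi> (at x) = (\<lambda>h. grad \<phi> x \<bullet> h)"
  proof
    fix h
    interpret bounded_linear "frechet_derivative \<phi> (at x)"
      using diff by (rule has_derivative_bounded_linear)
    have "frechet_derivative \<phi> (at x) h = frechet_derivative \<phi> (at x) (\<Sum>b\<in>Basis. (h \<bullet> b) *\<^sub>R b)"
      by (simp add: euclidean_representation)
    also have "\<dots> = grad \<phi> x \<bullet> h"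
      by (simp add: sum scaleR grad_def partial_deriv_def inner_sum_left inner_commute[of h] mult.commute)
    finally show "frechet_derivative \<phi> (at x) h = grad \<phi> x \<bullet> h" .
  qed
  with diff[of x] show "(\<phi> has_derivative (\<lambda>h. grad \<phi> x \<bullet> h)) (at x)" by simp
  have "\<And>b. b \<in> Basis \<Longrightarrow> continuous_on UNIV (partial_deriv b \<phi>)"
    using Ck[of "Suc 0"] by simp
  then show "continuous_on UNIV (grad \<phi>)"
    unfolding grad_def[abs_def] by (intro continuous_intros)
  show "\<phi> x = 0" if "x \<notin> \<Omega>"
    using supp that closure_subset[of "{x. \<phi> x \<noteq> 0}"] by auto
  show "grad \<phi> x = 0" if "x \<notin> closure {x. \<phi> x \<noteq> 0}"
  proof -
    \<comment> \<open>On the open complement of the support \<open>\<phi>\<close> coincides with the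
      zero function, and derivatives are unique.\<close>
    have "((\<lambda>_. 0) has_derivative frechet_derivative \<phi> (at x)) (at x)"
      using that closure_subset[of "{x. \<phi> x \<noteq> 0}"]
      by (intro has_derivative_transform_within_open[OF diff, of "- closure {x. \<phi> x \<noteq> 0}"]) auto
    then have "frechet_derivative \<phi> (at x) = (\<lambda>_. 0)"
      by (rule has_derivative_unique) simp
    then show ?thesis by (simp add: grad_def partial_deriv_def)
  qed
qed

lemma set_integral_eq_integral_if_zero_outside:
  fixes f :: "'a \<Rightarrow> 'b::{banach, second_countable_topology}"
  assumes "\<And>x. x \<notin> A \<Longrightarrow> f x = 0"
  shows "(LINT x:A|M. f x) = (LINT x|M. f x)"
  unfolding set_lebesgue_integral_def
  using assms by (intro Bochner_Integration.integral_cong) (auto split: split_indicator)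

lemma integrable_lborel_compact_support:
  fixes f :: "'a::euclidean_space \<Rightarrow> real"
  assumes "continuous_on UNIV f" "compact K" "\<And>x. x \<notin> K \<Longrightarrow> f x = 0"
  shows "integrable lborel f"
proof -
  have "integrable lborel (\<lambda>x. indicator K x *\<^sub>R f x)"
    by (rule borel_integrable_compact[OF assms(2) continuous_on_subset[OF assms(1)]]) simp
  moreover have "(\<lambda>x. indicator K x *\<^sub>R f x) = f"
  proof
    show "indicator K x *\<^sub>R f x = f x" for x
      using assms(3)[of x] by (cases "x \<in> K") auto
  qed
  ultimately show ?thesis by (simp only:)
qed

text \<open>Links the integrals over \<open>\<Omega>\<close> against \<open>lebesgue\<close> in the
  definitions with those over the whole space against \<open>lborel\<close> in the Poincare
  inequality. Continuity and compact support inside \<open>\<Omega>\<close> give both integrability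
  and equality.\<close>

lemma test_functions_powr:
  fixes \<phi> :: "'a::euclidean_space \<Rightarrow> real"
  assumes \<phi>: "\<phi> \<in> test_functions \<Omega>" and p: "0 < p"
  shows test_functions_integrable: "integrable lborel (\<lambda>x. \<bar>\<phi> x\<bar> powr p)"
    and test_functions_integrable_grad: "integrable lborel (\<lambda>x. norm (grad \<phi> x) powr p)"
    and test_functions_set_integral:
      "(LINT x:\<Omega>|lebesgue. \<bar>\<phi> x\<bar> powr p) = (LINT x|lborel. \<bar>\<phi> x\<bar> powr p)"
    and test_functions_set_integral_grad:
      "(LINT x:\<Omega>|lebesgue. norm (grad \<phi> x) powr p) = (LINT x|lborel. norm (grad \<phi> x) powr p)"
proof -
  let ?K = "closure {x. \<phi> x \<noteq> 0}"
  have K: "compact ?K" "?K \<subseteq> \<Omega>" using \<phi> by (simp_all add: test_functions_def)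
  have outside: "\<phi> x = 0" if "x \<notin> ?K" for x
    using that closure_subset[of "{x. \<phi> x \<noteq> 0}"] by auto
  have cont: "continuous_on UNIV (\<lambda>x. \<bar>\<phi> x\<bar> powr p)"
    "continuous_on UNIV (\<lambda>x. norm (grad \<phi> x) powr p)"
    using p test_functions_continuous[OF \<phi>] test_functions_continuous_grad[OF \<phi>]
    by (intro continuous_on_powr' continuous_on_norm continuous_on_rabs continuous_on_const; simp)+
  show "integrable lborel (\<lambda>x. \<bar>\<phi> x\<bar> powr p)"
    by (rule integrable_lborel_compact_support[OF cont(1) K(1)]) (drule outside, simp)
  show "integrable lborel (\<lambda>x. norm (grad \<phi> x) powr p)"
    by (rule integrable_lborel_compact_support[OF cont(2) K(1)])
      (drule test_functions_grad_eq_0[OF \<phi>], simp)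
  have "(LINT x:\<Omega>|lebesgue. \<bar>\<phi> x\<bar> powr p) = (LINT x|lebesgue. \<bar>\<phi> x\<bar> powr p)"
    by (rule set_integral_eq_integral_if_zero_outside) (simp add: test_functions_eq_0[OF \<phi>])
  also have "\<dots> = (LINT x|lborel. \<bar>\<phi> x\<bar> powr p)"
    using borel_measurable_continuous_onI[OF cont(1)] by (intro integral_completion) simp
  finally show "(LINT x:\<Omega>|lebesgue. \<bar>\<phi> x\<bar> powr p) = (LINT x|lborel. \<bar>\<phi> x\<bar> powr p)" .
  have "grad \<phi> x = 0" if "x \<notin> \<Omega>" for x
    using that K(2) by (intro test_functions_grad_eq_0[OF \<phi>]) blast
  then have "(LINT x:\<Omega>|lebesgue. norm (grad \<phi> x) powr p) = (LINT x|lebesgue. norm (grad \<phi> x) powr p)"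
    by (intro set_integral_eq_integral_if_zero_outside) simp
  also have "\<dots> = (LINT x|lborel. norm (grad \<phi> x) powr p)"
    using borel_measurable_continuous_onI[OF cont(2)] by (intro integral_completion) simp
  finally show "(LINT x:\<Omega>|lebesgue. norm (grad \<phi> x) powr p) = (LINT x|lborel. norm (grad \<phi> x) powr p)" .
qed

section \<open>The inradius and the Poincare inequality for test functions\<close>

text \<open>A real \<open>Sup\<close> is informative only for nonempty sets that are bounded above:
  the radii are bounded because \<open>\<Omega>\<close> lies in a ball, and a ball around any point
  of the open set \<open>\<Omega>\<close> provides a positive radius.\<close>

lemma inradius_pos_and_upper:
  fixes \<Omega> :: "'a::euclidean_space set"
  assumes "bounded_domain \<Omega>"
  shows inradius_pos: "0 < inradius \<Omega>"
    and inradius_upper: "\<And>x r. 0 < r \<Longrightarrow> ball x r \<subseteq> \<Omega> \<Longrightarrow> r \<le> inradius \<Omega>"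
proof -
  obtain a B where a: "\<Omega> \<subseteq> ball a B"
    using assms bounded_subset_ballD unfolding bounded_domain_def by blast
  have bdd: "bdd_above {r. r > 0 \<and> (\<exists>x. ball x r \<subseteq> \<Omega>)}"
  proof (rule bdd_aboveI)
    fix r assume "r \<in> {r. r > 0 \<and> (\<exists>x. ball x r \<subseteq> \<Omega>)}"
    then obtain x where "0 < r" "ball x r \<subseteq> ball a B" using a by auto
    then have "dist x a + r \<le> B" by (simp add: ball_subset_ball_iff)
    then show "r \<le> B" using zero_le_dist[of x a] by linarith
  qed
  show upper: "r \<le> inradius \<Omega>" if "0 < r" "ball x r \<subseteq> \<Omega>" for x r
    unfolding inradius_def using that by (intro cSup_upper bdd) auto
  obtain x where "x \<in> \<Omega>" using assms by (auto simp: bounded_domain_def)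
  then obtain r where "0 < r" "ball x r \<subseteq> \<Omega>"
    using assms by (auto simp: bounded_domain_def open_contains_ball)
  then show "0 < inradius \<Omega>" using upper by fastforce
qed

lemma poincare_test_functions:
  fixes \<phi> :: "'a::euclidean_space \<Rightarrow> real"
  assumes \<Omega>: "bounded_domain \<Omega>" and \<phi>: "\<phi> \<in> test_functions \<Omega>"
    and p: "1 < p" and m: "1 < m" "real m * DIM('a) \<le> real (m - 1) * p"
  shows "(LINT x|lborel. \<bar>\<phi> x\<bar> powr p) \<le>
    (4 * real m * DIM('a) * inradius \<Omega>) powr p * (LINT x|lborel. norm (grad \<phi> x) powr p)"
proof -
  have pos: "0 < inradius \<Omega>" by (rule inradius_pos[OF \<Omega>])
  have zeros: "\<exists>z\<in>ball y (4 * inradius \<Omega> / 2). \<phi> z = 0" for y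
  proof -
    \<comment> \<open>The supremum itself may be attained, so a strictly larger radius is taken; it
      is \<open>L / 2\<close> for cubes of side \<open>L = 4 * inradius \<Omega>\<close>.\<close>
    have "\<not> ball y (2 * inradius \<Omega>) \<subseteq> \<Omega>"
      using inradius_upper[OF \<Omega>, of "2 * inradius \<Omega>" y] pos by auto
    then show ?thesis using test_functions_eq_0[OF \<phi>] by auto
  qed
  have "ennreal (LINT x|lborel. \<bar>\<phi> x\<bar> powr p) = (\<integral>\<^sup>+x. ennreal (\<bar>\<phi> x\<bar> powr p) \<partial>lborel)"
    using p by (intro nn_integral_eq_integral[symmetric] test_functions_integrable[OF \<phi>]) auto
  also have "\<dots> \<le> ennreal ((real m * (DIM('a) * (4 * inradius \<Omega>))) powr p) *
      (\<integral>\<^sup>+x. ennreal (norm (grad \<phi> x) powr p) \<partial>lborel)"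
    using pos zeros
    by (intro nn_integral_powr_le_dense_zeros test_functions_has_derivative[OF \<phi>]
        test_functions_continuous_grad[OF \<phi>] p m) auto
  also have "(\<integral>\<^sup>+x. ennreal (norm (grad \<phi> x) powr p) \<partial>lborel) =
      ennreal (LINT x|lborel. norm (grad \<phi> x) powr p)"
    using p by (intro nn_integral_eq_integral test_functions_integrable_grad[OF \<phi>]) auto
  finally show ?thesis
    by (simp add: mult_ac flip: ennreal_mult')
qed

text \<open>Secures the denominators of the Rayleigh quotients. A vanishing integral would force
  \<open>\<phi>\<close> to be zero almost everywhere, whereas the set where it is nonzero is open
  and nonempty, hence not negligible.\<close>

lemma test_functions_integral_pos:
  fixes \<phi> :: "'a::euclidean_space \<Rightarrow> real"
  assumes \<phi>: "\<phi> \<in> test_functions \<Omega>" and p: "0 < p" and nz: "\<phi> \<noteq> (\<lambda>x. 0)"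
  shows "0 < (LINT x|lborel. \<bar>\<phi> x\<bar> powr p)"
proof (rule ccontr)
  assume "\<not> ?thesis"
  moreover have "0 \<le> (LINT x|lborel. \<bar>\<phi> x\<bar> powr p)"
    by (rule Bochner_Integration.integral_nonneg) simp
  ultimately have "(LINT x|lborel. \<bar>\<phi> x\<bar> powr p) = 0" by linarith
  then have "AE x in lborel. \<bar>\<phi> x\<bar> powr p = 0"
    using integral_nonneg_eq_0_iff_AE[OF test_functions_integrable[OF \<phi> p]] by simp
  then have AE: "AE x in lborel. \<phi> x = 0"
    by (rule AE_mp) (simp add: p)
  have "open {x. \<phi> x \<noteq> 0}"
    using test_functions_continuous[OF \<phi>] by (intro open_Collect_neq) auto
  moreover from this have "{x \<in> space lborel. \<phi> x \<noteq> 0} \<in> null_sets lborel"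
    using AE by (subst AE_iff_null[symmetric]) auto
  then have "negligible {x. \<phi> x \<noteq> 0}"
    by (simp add: negligible_iff_null_sets null_sets_completionI)
  moreover have "{x. \<phi> x \<noteq> 0} \<noteq> {}"
    using nz by (simp add: fun_eq_iff)
  ultimately show False
    using open_not_negligible[of "{x. \<phi> x \<noteq> 0}"] by blast
qed

section \<open>Power estimates and limits in the \<open>p\<close>-th mean\<close>

text \<open>A crude form of the triangle inequality for \<open>p\<close>-th powers:
  \<open>norm a\<close> is at most twice the larger of the two norms. Each use costs a factor
  \<open>2 powr p\<close>.\<close>

lemma norm_powr_le_diff:
  fixes a b :: "'a::real_normed_vector"
  assumes "0 < p"
  shows "norm a powr p \<le> 2 powr p * (norm b powr p + norm (a - b) powr p)"
proof -
  have "norm a \<le> 2 * max (norm b) (norm (a - b))"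
    using norm_triangle_ineq[of b "a - b"] by simp
  then have "norm a powr p \<le> (2 * max (norm b) (norm (a - b))) powr p"
    using assms by (intro powr_mono2) auto
  also have "\<dots> = 2 powr p * max (norm b) (norm (a - b)) powr p"
    by (simp add: powr_mult)
  also have "\<dots> \<le> 2 powr p * (norm b powr p + norm (a - b) powr p)"
    by (intro mult_left_mono) (auto simp: max_def)
  finally show ?thesis .
qed

lemma integrable_norm_powr_diff:
  fixes f g :: "'a \<Rightarrow> 'b::euclidean_space"
  assumes p: "0 < p"
    and [measurable]: "f \<in> borel_measurable M" "g \<in> borel_measurable M"
    and int: "integrable M (\<lambda>x. norm (f x) powr p)" "integrable M (\<lambda>x. norm (g x) powr p)"
  shows "integrable M (\<lambda>x. norm (f x - g x) powr p)"
proof (rule Bochner_Integration.integrable_bound)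
  show "integrable M (\<lambda>x. 2 powr p * (norm (f x) powr p + norm (g x) powr p))"
    using int by simp
  show "AE x in M. norm (norm (f x - g x) powr p)
      \<le> norm (2 powr p * (norm (f x) powr p + norm (g x) powr p))"
    using norm_powr_le_diff[OF p, of "f x - g x" "f x" for x] by simp
qed measurable

text \<open>A weighted Young inequality: one of the two terms alone bounds the product, according to
  whether \<open>b \<le> e * a\<close>. A small \<open>e\<close> makes the first coefficient small
  at the price of a large second one.\<close>

lemma powr_mult_le:
  fixes a b e p :: real
  assumes "1 < p" "0 \<le> a" "0 \<le> b" "0 < e"
  shows "a powr (p - 1) * b \<le> e * a powr p + e powr (1 - p) * b powr p"
proof (cases "b \<le> e * a")
  case True
  have "a powr (p - 1) * b \<le> a powr (p - 1) * (e * a)"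
    using True by (intro mult_left_mono) auto
  also have "\<dots> = e * a powr p"
    using assms by (cases "a = 0") (auto simp: powr_diff)
  also have "\<dots> \<le> e * a powr p + e powr (1 - p) * b powr p" by simp
  finally show ?thesis .
next
  case False
  with assms have b: "0 < b" "a \<le> b / e"
    by (auto simp: field_simps intro: le_less_trans[of 0 "e * a"])
  then have "a powr (p - 1) * b \<le> (b / e) powr (p - 1) * b"
    using assms by (intro mult_right_mono powr_mono2) auto
  also have "\<dots> = e powr (1 - p) * b powr p"
    using assms b by (simp add: powr_divide powr_diff field_simps)
  also have "\<dots> \<le> e * a powr p + e powr (1 - p) * b powr p"
    using assms by simp
  finally show ?thesis .
qed

text \<open>The error of the pairing is at most \<open>e * A + e powr (1 - p) * R n\<close> for
  every \<open>e > 0\<close>; first \<open>e\<close> is fixed, then \<open>n\<close> grows. Values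
  in a Euclidean space let the lemma serve both the eigenfunction and its gradient.\<close>

lemma tendsto_duality_pairing:
  fixes f :: "'a \<Rightarrow> 'b::euclidean_space"
  assumes p: "1 < p"
    and [measurable]: "f \<in> borel_measurable M" "\<And>n. F n \<in> borel_measurable M"
    and int: "integrable M (\<lambda>x. norm (f x) powr p)" "\<And>n. integrable M (\<lambda>x. norm (F n x) powr p)"
    and lim: "(\<lambda>n. LINT x|M. norm (F n x - f x) powr p) \<longlonglongrightarrow> 0"
  shows "(\<lambda>n. LINT x|M. norm (f x) powr (p - 2) * (f x \<bullet> F n x)) \<longlonglongrightarrow> (LINT x|M. norm (f x) powr p)"
proof -
  define A where "A = (LINT x|M. norm (f x) powr p)"
  define R where "R n = (LINT x|M. norm (F n x - f x) powr p)" for n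
  have A: "0 \<le> A" unfolding A_def by (rule Bochner_Integration.integral_nonneg) simp
  have idiff: "integrable M (\<lambda>x. norm (F n x - f x) powr p)" for n
    using p by (intro integrable_norm_powr_diff int) auto
  have ptw: "norm (norm (f x) powr (p - 2) * (f x \<bullet> (F n x - f x))) \<le>
      e * norm (f x) powr p + e powr (1 - p) * norm (F n x - f x) powr p" if "0 < e" for e n x
  proof -
    have "norm (norm (f x) powr (p - 2) * (f x \<bullet> (F n x - f x)))
        \<le> norm (f x) powr (p - 2) * (norm (f x) * norm (F n x - f x))"
      by (simp add: abs_mult mult_left_mono Cauchy_Schwarz_ineq2)
    \<comment> \<open>Where \<open>f\<close> vanishes both sides are 0, so a negative exponent
      \<open>p - 2\<close> does no harm.\<close>
    also have "\<dots> = norm (f x) powr (p - 1) * norm (F n x - f x)"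
    proof (cases "f x = 0")
      case False
      then have "norm (f x) powr (p - 1) = norm (f x) powr (p - 2) * norm (f x) powr 1"
        by (subst powr_add[symmetric]) simp
      with False show ?thesis by simp
    qed simp
    also have "\<dots> \<le> e * norm (f x) powr p + e powr (1 - p) * norm (F n x - f x) powr p"
      using p that by (intro powr_mult_le) auto
    finally show ?thesis .
  qed
  have ibound: "integrable M (\<lambda>x. e * norm (f x) powr p + e powr (1 - p) * norm (F n x - f x) powr p)" for e n
    using int idiff by simp
  have ierr: "integrable M (\<lambda>x. norm (f x) powr (p - 2) * (f x \<bullet> (F n x - f x)))" for n
  proof (rule Bochner_Integration.integrable_bound[OF ibound[of 1 n]])
    show "AE x in M. norm (norm (f x) powr (p - 2) * (f x \<bullet> (F n x - f x)))
        \<le> norm (1 * norm (f x) powr p + 1 powr (1 - p) * norm (F n x - f x) powr p)"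
      using ptw[of 1] by (intro AE_I2) simp
  qed measurable
  have split: "norm (f x) powr (p - 2) * (f x \<bullet> F n x) =
      norm (f x) powr (p - 2) * (f x \<bullet> (F n x - f x)) + norm (f x) powr p" for n x
  proof (cases "f x = 0")
    case False
    have "norm (f x) powr p = norm (f x) powr (p - 2) * norm (f x) powr 2"
      by (subst powr_add[symmetric]) simp
    also have "norm (f x) powr 2 = f x \<bullet> f x"
      using False by (simp add: power2_norm_eq_inner)
    finally show ?thesis by (simp add: algebra_simps)
  qed (use p in simp)
  have bound: "norm ((LINT x|M. norm (f x) powr (p - 2) * (f x \<bullet> F n x)) - A) \<le> e * A + e powr (1 - p) * R n"
    if "0 < e" for e n
  proof -
    have "(LINT x|M. norm (f x) powr (p - 2) * (f x \<bullet> F n x)) - A =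
        (LINT x|M. norm (f x) powr (p - 2) * (f x \<bullet> (F n x - f x)))"
      unfolding A_def split by (subst Bochner_Integration.integral_add[OF ierr int(1)]) simp
    also have "norm \<dots> \<le> (LINT x|M. norm (norm (f x) powr (p - 2) * (f x \<bullet> (F n x - f x))))"
      by (rule Bochner_Integration.integral_norm_bound)
    also have "\<dots> \<le> (LINT x|M. e * norm (f x) powr p + e powr (1 - p) * norm (F n x - f x) powr p)"
      by (intro Bochner_Integration.integral_mono Bochner_Integration.integrable_norm ierr ibound ptw that)
    also have "\<dots> = e * A + e powr (1 - p) * R n"
      using int idiff by (simp add: A_def R_def)
    finally show ?thesis .
  qed
  show ?thesis
    unfolding A_def[symmetric]
  proof (rule LIMSEQ_I)
    fix r :: real assume r: "0 < r"
    \<comment> \<open>The summand 1 avoids a division by zero when \<open>A = 0\<close>.\<close>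
    define e where "e = r / (2 * (A + 1))"
    have e: "0 < e" "e * A < r / 2" using r A by (simp_all add: e_def field_simps)
    have "(\<lambda>n. e powr (1 - p) * R n) \<longlonglongrightarrow> e powr (1 - p) * 0"
      using lim unfolding R_def by (intro tendsto_mult_left)
    then have "(\<lambda>n. e * A + e powr (1 - p) * R n) \<longlonglongrightarrow> e * A + e powr (1 - p) * 0"
      by (intro tendsto_add tendsto_const)
    then have "eventually (\<lambda>n. e * A + e powr (1 - p) * R n < r) sequentially"
      by (rule order_tendstoD(2)) (use e r in simp)
    then have "eventually (\<lambda>n. norm ((LINT x|M. norm (f x) powr (p - 2) * (f x \<bullet> F n x)) - A) < r) sequentially"
      by eventually_elim (use bound[OF e(1)] le_less_trans in blast)
    then show "\<exists>N. \<forall>n\<ge>N. norm ((LINT x|M. norm (f x) powr (p - 2) * (f x \<bullet> F n x)) - A) < r"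
      by (simp add: eventually_sequentially)
  qed
qed

section \<open>Lower bound for every eigenvalue\<close>

text \<open>The weak equation can be tested only with test functions, so \<open>u\<close> is reached
  through its approximants \<open>\<phi> n\<close>. In the limit the equation becomes
  \<open>l * a = b\<close>, where \<open>a\<close> and \<open>b\<close> are the \<open>p\<close>-th
  power integrals of \<open>u\<close> and \<open>g\<close> over \<open>\<Omega>\<close>, and the
  Poincare inequality bounds \<open>a\<close> by a multiple of \<open>b\<close>.\<close>

lemma dirichlet_eigenvalue_ge:
  fixes \<Omega> :: "'a::euclidean_space set"
  assumes \<Omega>: "bounded_domain \<Omega>" and p: "1 < p"
    and poincare: "\<And>\<phi>. \<phi> \<in> test_functions \<Omega> \<Longrightarrow>
      (LINT x|lborel. \<bar>\<phi> x\<bar> powr p) \<le> K * (LINT x|lborel. norm (grad \<phi> x) powr p)"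
    and K: "0 < K" and ev: "dirichlet_eigenvalue p \<Omega> l"
  shows "1 / (4 powr p * K) \<le> l"
proof -
  obtain u g where W: "W1p0 p \<Omega> u g"
    and nz: "\<not> (AE x in lebesgue. x \<in> \<Omega> \<longrightarrow> u x = 0)"
    and weak: "\<And>\<phi>. \<phi> \<in> test_functions \<Omega> \<Longrightarrow>
      (LINT x:\<Omega>|lebesgue. norm (g x) powr (p - 2) * (g x \<bullet> grad \<phi> x)) =
       l * (LINT x:\<Omega>|lebesgue. \<bar>u x\<bar> powr (p - 2) * u x * \<phi> x)"
    using ev unfolding dirichlet_eigenvalue_def by blast
  obtain \<phi> :: "nat \<Rightarrow> 'a \<Rightarrow> real" where \<phi>: "\<And>n. \<phi> n \<in> test_functions \<Omega>"
    and lim_u: "(\<lambda>n. LINT x:\<Omega>|lebesgue. \<bar>\<phi> n x - u x\<bar> powr p) \<longlonglongrightarrow> 0"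
    and lim_g: "(\<lambda>n. LINT x:\<Omega>|lebesgue. norm (grad (\<phi> n) x - g x) powr p) \<longlonglongrightarrow> 0"
    using W unfolding W1p0_def by blast
  have Lp: "Lp_on p \<Omega> u" "Lp_on p \<Omega> g"
    using W by (simp_all add: W1p0_def W1p_def)
  \<comment> \<open>Extension by zero allows whole-space integrals throughout.\<close>
  define U where "U x = indicator \<Omega> x *\<^sub>R u x" for x
  define V where "V x = indicator \<Omega> x *\<^sub>R g x" for x
  have meas [measurable]: "U \<in> borel_measurable lebesgue" "V \<in> borel_measurable lebesgue"
    using Lp by (simp_all add: Lp_on_def set_borel_measurable_def U_def[abs_def] V_def[abs_def])
  have int: "integrable lebesgue (\<lambda>x. norm (U x) powr p)" "integrable lebesgue (\<lambda>x. norm (V x) powr p)"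
  proof -
    have "(\<lambda>x. norm (U x) powr p) = (\<lambda>x. indicator \<Omega> x *\<^sub>R norm (u x) powr p)"
      "(\<lambda>x. norm (V x) powr p) = (\<lambda>x. indicator \<Omega> x *\<^sub>R norm (g x) powr p)"
      by (auto simp: U_def V_def fun_eq_iff split: split_indicator)
    then show "integrable lebesgue (\<lambda>x. norm (U x) powr p)" "integrable lebesgue (\<lambda>x. norm (V x) powr p)"
      using Lp by (simp_all add: Lp_on_def set_integrable_def)
  qed
  have out: "\<phi> n x = 0" "grad (\<phi> n) x = 0" if "x \<notin> \<Omega>" for n x
  proof -
    show "\<phi> n x = 0" by (rule test_functions_eq_0[OF \<phi> that])
    have "closure {x. \<phi> n x \<noteq> 0} \<subseteq> \<Omega>" using \<phi>[of n] by (simp add: test_functions_def)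
    then show "grad (\<phi> n) x = 0"
      using that by (intro test_functions_grad_eq_0[OF \<phi>]) blast
  qed
  have meas_\<phi> [measurable]: "\<phi> n \<in> borel_measurable lebesgue" "grad (\<phi> n) \<in> borel_measurable lebesgue" for n
    using borel_measurable_continuous_onI[OF test_functions_continuous[OF \<phi>]]
      borel_measurable_continuous_onI[OF test_functions_continuous_grad[OF \<phi>]]
    by (simp_all add: measurable_completion)
  have int_\<phi>: "integrable lebesgue (\<lambda>x. norm (\<phi> n x) powr p)"
    "integrable lebesgue (\<lambda>x. norm (grad (\<phi> n) x) powr p)" for n
    using test_functions_integrable[OF \<phi>, of p n] test_functions_integrable_grad[OF \<phi>, of p n] p
    by (auto simp: integrable_completion)
  have set_eq: "(LINT x:\<Omega>|lebesgue. F x) = (LINT x|lebesgue. H x)"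
    if "\<And>x. x \<in> \<Omega> \<Longrightarrow> F x = H x" "\<And>x. x \<notin> \<Omega> \<Longrightarrow> H x = 0" for F H :: "'a \<Rightarrow> real"
    unfolding set_lebesgue_integral_def
    using that by (intro Bochner_Integration.integral_cong) (auto split: split_indicator)
  define a where "a = (LINT x|lebesgue. norm (U x) powr p)"
  define b where "b = (LINT x|lebesgue. norm (V x) powr p)"
  define \<epsilon> where "\<epsilon> n = (LINT x|lebesgue. norm (\<phi> n x - U x) powr p)" for n
  define \<delta> where "\<delta> n = (LINT x|lebesgue. norm (grad (\<phi> n) x - V x) powr p)" for n
  have \<epsilon>: "\<epsilon> \<longlonglongrightarrow> 0"
  proof -
    have "(LINT x:\<Omega>|lebesgue. \<bar>\<phi> n x - u x\<bar> powr p) = \<epsilon> n" for n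
      unfolding \<epsilon>_def by (rule set_eq) (simp_all add: U_def out)
    then show ?thesis using lim_u by simp
  qed
  have \<delta>: "\<delta> \<longlonglongrightarrow> 0"
  proof -
    have "(LINT x:\<Omega>|lebesgue. norm (grad (\<phi> n) x - g x) powr p) = \<delta> n" for n
      unfolding \<delta>_def by (rule set_eq) (simp_all add: V_def out)
    then show ?thesis using lim_g by simp
  qed
  \<comment> \<open>On the reals the inner product is multiplication, so both sides have the form
    treated by \<open>tendsto_duality_pairing\<close>.\<close>
  have eq: "(LINT x|lebesgue. norm (V x) powr (p - 2) * (V x \<bullet> grad (\<phi> n) x)) =
      l * (LINT x|lebesgue. norm (U x) powr (p - 2) * (U x \<bullet> \<phi> n x))" for n
  proof -
    have "(LINT x:\<Omega>|lebesgue. norm (g x) powr (p - 2) * (g x \<bullet> grad (\<phi> n) x)) =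
        (LINT x|lebesgue. norm (V x) powr (p - 2) * (V x \<bullet> grad (\<phi> n) x))"
      by (rule set_eq) (simp_all add: V_def)
    moreover have "(LINT x:\<Omega>|lebesgue. \<bar>u x\<bar> powr (p - 2) * u x * \<phi> n x) =
        (LINT x|lebesgue. norm (U x) powr (p - 2) * (U x \<bullet> \<phi> n x))"
      by (rule set_eq) (simp_all add: U_def)
    ultimately show ?thesis using weak[OF \<phi>[of n]] by simp
  qed
  have "(\<lambda>n. l * (LINT x|lebesgue. norm (U x) powr (p - 2) * (U x \<bullet> \<phi> n x))) \<longlonglongrightarrow> l * a"
    unfolding a_def using \<epsilon> p int int_\<phi>
    by (intro tendsto_mult_left tendsto_duality_pairing) (simp_all add: \<epsilon>_def[abs_def])
  moreover have "(\<lambda>n. l * (LINT x|lebesgue. norm (U x) powr (p - 2) * (U x \<bullet> \<phi> n x))) \<longlonglongrightarrow> b"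
    unfolding b_def eq[symmetric] using \<delta> p int int_\<phi>
    by (intro tendsto_duality_pairing) (simp_all add: \<delta>_def[abs_def])
  ultimately have la: "l * a = b"
    by (rule LIMSEQ_unique)
  have int_diff: "integrable lebesgue (\<lambda>x. norm (\<phi> n x - U x) powr p)"
    "integrable lebesgue (\<lambda>x. norm (grad (\<phi> n) x - V x) powr p)" for n
    using p by (intro integrable_norm_powr_diff meas meas_\<phi> int int_\<phi>; simp)+
  \<comment> \<open>Pass from \<open>U\<close> to \<open>\<phi> n\<close>, apply the Poincare
    inequality, and pass from \<open>grad (\<phi> n)\<close> back to \<open>V\<close>. The two
    passages cost \<open>2 powr p\<close> each, whence the factor \<open>4 powr p\<close>.\<close>
  have le: "a \<le> 2 powr p * (K * (2 powr p * (b + \<delta> n)) + \<epsilon> n)" for n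
  proof -
    have "a \<le> (LINT x|lebesgue. 2 powr p * (norm (\<phi> n x) powr p + norm (\<phi> n x - U x) powr p))"
      unfolding a_def using p int int_\<phi> int_diff norm_powr_le_diff[of p "U x" "\<phi> n x" for x]
      by (intro Bochner_Integration.integral_mono) (auto simp: abs_minus_commute)
    also have "\<dots> = 2 powr p * ((LINT x|lebesgue. norm (\<phi> n x) powr p) + \<epsilon> n)"
      using int_\<phi> int_diff by (simp add: \<epsilon>_def)
    also have "(LINT x|lebesgue. norm (\<phi> n x) powr p) = (LINT x|lborel. \<bar>\<phi> n x\<bar> powr p)"
      using borel_measurable_integrable[OF test_functions_integrable[OF \<phi>[of n], of p]] p
      by (simp add: integral_completion)
    also have "\<dots> \<le> K * (LINT x|lborel. norm (grad (\<phi> n) x) powr p)"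
      by (rule poincare[OF \<phi>])
    also have "(LINT x|lborel. norm (grad (\<phi> n) x) powr p) = (LINT x|lebesgue. norm (grad (\<phi> n) x) powr p)"
      using borel_measurable_integrable[OF test_functions_integrable_grad[OF \<phi>[of n], of p]] p
      by (simp add: integral_completion)
    also have "\<dots> \<le> (LINT x|lebesgue. 2 powr p * (norm (V x) powr p + norm (grad (\<phi> n) x - V x) powr p))"
      using p int int_\<phi> int_diff norm_powr_le_diff[of p "grad (\<phi> n) x" "V x" for x]
      by (intro Bochner_Integration.integral_mono) auto
    also have "\<dots> = 2 powr p * (b + \<delta> n)"
      using int int_diff by (simp add: \<delta>_def b_def)
    finally show ?thesis using K by simp
  qed
  have "(\<lambda>n. 2 powr p * (K * (2 powr p * (b + \<delta> n)) + \<epsilon> n)) \<longlonglongrightarrow>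
      2 powr p * (K * (2 powr p * (b + 0)) + 0)"
    by (intro tendsto_intros \<epsilon> \<delta>)
  then have "a \<le> 2 powr p * (K * (2 powr p * (b + 0)) + 0)"
    by (rule LIMSEQ_le_const) (use le in blast)
  also have "\<dots> = 4 powr p * K * b"
    using powr_mult[of 2 2 p] by simp
  finally have ab: "a \<le> 4 powr p * K * (l * a)"
    by (simp add: la)
  have a0: "0 \<le> a" unfolding a_def by (rule Bochner_Integration.integral_nonneg) simp
  \<comment> \<open>Nontriviality of the eigenfunction allows \<open>a\<close> to be
    cancelled.\<close>
  have "a \<noteq> 0"
  proof
    assume "a = 0"
    then have "AE x in lebesgue. norm (U x) powr p = 0"
      unfolding a_def using integral_nonneg_eq_0_iff_AE[OF int(1)] by simp
    then have "AE x in lebesgue. x \<in> \<Omega> \<longrightarrow> u x = 0"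
      by eventually_elim (auto simp: U_def)
    with nz show False by contradiction
  qed
  with a0 have "0 < a" by simp
  moreover have "1 * a \<le> (4 powr p * K * l) * a"
    using ab by (simp add: mult_ac)
  ultimately have "1 \<le> 4 powr p * K * l"
    by (simp only: mult_le_cancel_right_pos)
  with K show ?thesis
    by (simp add: divide_le_eq mult_ac)
qed

section \<open>Choice of the constant and the bound for both infima\<close>

theorem theorem1p4p1:
  fixes p :: real
  assumes "real CARD('n::finite) < p"
  shows "\<exists>C>0. \<forall>\<Omega> :: (real ^ 'n) set. bounded_domain \<Omega> \<longrightarrow>
    ereal (C * inradius \<Omega> powr (- p)) \<le> first_eigenvalue p \<Omega> \<and>
    ereal (C * inradius \<Omega> powr (- p)) \<le> rayleigh_infimum p \<Omega>"
proof -
  let ?N = "CARD('n)"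
  have p: "1 < p"
    using assms zero_less_card_finite[where ?'a='n] by linarith
  \<comment> \<open>The condition on \<open>m\<close> in the Poincare inequality amounts to
    \<open>m \<ge> p / (p - ?N)\<close>; adding 1 ensures \<open>1 < m\<close>.\<close>
  obtain m :: nat where m_gt: "p / (p - ?N) + 1 < m"
    using reals_Archimedean2 by blast
  have "0 < p / (p - ?N)" using assms p by simp
  with m_gt have m1: "1 < m" by linarith
  have "p < real m * (p - ?N)"
    using m_gt assms p by (simp add: field_simps)
  then have m2: "real m * ?N \<le> real (m - 1) * p"
    using m1 by (simp add: of_nat_diff algebra_simps)
  \<comment> \<open>The first factor is the loss in the limit argument, the second is the Poincare
    constant without its power of the inradius.\<close>
  define C where "C = 1 / (4 powr p * (4 * real m * ?N) powr p)"
  have C: "0 < C" using m1 by (simp add: C_def)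
  show ?thesis
  proof (intro exI[of _ C] conjI C allI impI)
    fix \<Omega> :: "(real ^ 'n) set" assume \<Omega>: "bounded_domain \<Omega>"
    have \<rho>: "0 < inradius \<Omega>" by (rule inradius_pos[OF \<Omega>])
    define K where "K = (4 * real m * ?N * inradius \<Omega>) powr p"
    have K: "0 < K" using \<rho> m1 by (simp add: K_def)
    have CK: "C * inradius \<Omega> powr (- p) = 1 / (4 powr p * K)"
      using \<rho> m1 by (simp add: C_def K_def powr_minus powr_mult field_simps)
    have poincare: "(LINT x|lborel. \<bar>\<phi> x\<bar> powr p) \<le> K * (LINT x|lborel. norm (grad \<phi> x) powr p)"
      if "\<phi> \<in> test_functions \<Omega>" for \<phi>
      using poincare_test_functions[OF \<Omega> that p m1] m2 by (simp add: K_def)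
    show "ereal (C * inradius \<Omega> powr (- p)) \<le> first_eigenvalue p \<Omega>"
      unfolding first_eigenvalue_def CK
      using dirichlet_eigenvalue_ge[OF \<Omega> p poincare K] by (intro INF_greatest) simp
    show "ereal (C * inradius \<Omega> powr (- p)) \<le> rayleigh_infimum p \<Omega>"
      unfolding rayleigh_infimum_def CK
    proof (rule INF_greatest)
      fix \<phi> assume "\<phi> \<in> test_functions \<Omega> - {\<lambda>x. 0}"
      then have \<phi>: "\<phi> \<in> test_functions \<Omega>" "\<phi> \<noteq> (\<lambda>x. 0)" by auto
      define D where "D = (LINT x:\<Omega>|lebesgue. \<bar>\<phi> x\<bar> powr p)"
      define E where "E = (LINT x:\<Omega>|lebesgue. norm (grad \<phi> x) powr p)"
      have D: "0 < D"
        using test_functions_integral_pos[OF \<phi>(1) _ \<phi>(2), of p] p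
        by (simp add: D_def test_functions_set_integral[OF \<phi>(1)])
      have "D \<le> K * E"
        using poincare[OF \<phi>(1)] p
        by (simp add: D_def E_def test_functions_set_integral[OF \<phi>(1)] test_functions_set_integral_grad[OF \<phi>(1)])
      then have "1 / K \<le> E / D"
        using K D by (simp add: field_simps)
      \<comment> \<open>Test functions satisfy the better bound \<open>1 / K\<close>; it is weakened
        so that one \<open>C\<close> serves both infima.\<close>
      moreover have "1 / (4 powr p * K) \<le> 1 / K"
        using K p ge_one_powr_ge_zero[of 4 p] by (intro divide_left_mono) auto
      ultimately show "ereal (1 / (4 powr p * K)) \<le> ereal ((LINT x:\<Omega>|lebesgue. norm (grad \<phi> x) powr p) /
          (LINT x:\<Omega>|lebesgue. \<bar>\<phi> x\<bar> powr p))"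
        by (simp add: D_def E_def)
    qed
  qed
qed

end
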